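(* Let $d\geq2$ be an integer, and let $1\leq m\leq d$ be an integer. There exists a set $K\subset\mathbb{R}^d$ such that (i) $K$ is compact; (ii) $K$ contains $(k,\varepsilon,\{e_1,\ldots,e_m\})$-APs for all integers $k\geq3$, all $\varepsilon\in(0,1)$, and all $\{e_1,\ldots,e_m\}\in B^d_m$ (i.e. for all such $k$, $\varepsilon$ and $\{e_1,\ldots,e_m\}$ there is a $(k,\varepsilon,\{e_1,\ldots,e_m\})$-AP $Q$ with $Q\subseteq K$); (iii) $\dim_{\mathrm{A}}K=m$.
   Context: $\|\cdot\|$ is the Euclidean norm on $\mathbb{R}^d$. For integers $1\leq m\leq d$, $$B^d_m=\big\{\{e_1,\ldots,e_m\}\colon \{e_1,\ldots,e_m\}\subset\mathbb{R}^d\text{ is linearly independent}\big\}$$ is the collection of all linearly independent sets of $m$ vectors in $\mathbb{R}^d$ (the vectors need not be unit vectors). Arithmetic patches. Let $\{e_1,\ldots,e_m\}\in B^d_m$. For $k\in\mathbb{N}$ and $\Delta>0$, a set $P\subset\mathbb{R}^d$ is an arithmetic patch of size $k$ and scale $\Delta$ with respect to orientation $\{e_1,\ldots,e_m\}$ if $$P=\left\{t+\Delta\sum_{i=1}^m x_ie_i \colon x_i=0,1,\ldots,k-1\right\}$$ for some $t\in\mathbb{R}^d$. For $\varepsilon\in[0,1)$, a set $Q\subset\mathbb{R}^d$ is a $(k,\varepsilon,\{e_1,\ldots,e_m\})$-AP if there exists an arithmetic patch $P$ of size $k$ and some scale $\Delta>0$ with respect to orientation $\{e_1,\ldots,e_m\}$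 such that $\#Q=\#P$ and $\inf_{y\in Q}\|x-y\|\leq\varepsilon\Delta$ for all $x\in P$. Assouad dimension. For bounded $E\subset\mathbb{R}^d$ and $r>0$, $N(E,r)$ is the smallest number of open sets with diameter at most $r$ required to cover $E$. For $F\subseteq\mathbb{R}^d$, $\dim_{\mathrm{A}}F$ is the infimum of all $\sigma\geq0$ for which there exists $C>0$ such that for all $R>0$, all $r\in(0,R)$ and all $x\in F$, $$N\big(B(x,R)\cap F,r\big)\leq C\left(\frac{R}{r}\right)^{\sigma},$$ where $B(x,R)$ is the closed ball with centre $x$ and radius $R$. *)

theory Defs
  imports "HOL-Analysis.Analysis"
begin

definition indep_sets_of_card :: "nat \<Rightarrow> ('a::euclidean_space) set set" where
  "indep_sets_of_card m = {E. independent E \<and> finite E \<and> card E = m}"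

text \<open>The orientation is an unindexed set of vectors, so the integer coefficients
  are given by a function on the vectors themselves.\<close>

definition arithmetic_patch :: "nat \<Rightarrow> real \<Rightarrow> ('a::euclidean_space) set \<Rightarrow> 'a set \<Rightarrow> bool" where
  "arithmetic_patch k \<Delta> E P \<longleftrightarrow>
     (\<exists>t. P = {t + \<Delta> *\<^sub>R (\<Sum>e\<in>E. real (x e) *\<^sub>R e) |x :: 'a \<Rightarrow> nat. \<forall>e\<in>E. x e < k})"

text \<open>Patches over a finite orientation are finite; \<open>finite Q\<close> is needed because
  \<open>card\<close> is 0 on infinite sets.\<close>

definition is_AP :: "nat \<Rightarrow> real \<Rightarrow> ('a::euclidean_space) set \<Rightarrow> 'a set \<Rightarrow> bool" where
  "is_AP k \<epsilon> E Q \<longleftrightarrow>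
     (\<exists>\<Delta>>0. \<exists>P. arithmetic_patch k \<Delta> E P \<and> finite Q \<and> card Q = card P \<and>
        (\<forall>x\<in>P. (INF y\<in>Q. norm (x - y)) \<le> \<epsilon> * \<Delta>))"

text \<open>Intended for bounded \<open>E\<close> and \<open>r > 0\<close>, where a finite cover exists by total
  boundedness.  Boundedness of the covering sets is required explicitly because the real-valued
  \<open>diameter\<close> of an unbounded set is unspecified.\<close>

definition covering_number :: "('a::euclidean_space) set \<Rightarrow> real \<Rightarrow> nat" where
  "covering_number E r =
     (LEAST n. \<exists>\<U>. finite \<U> \<and> card \<U> = n \<and>
        (\<forall>U\<in>\<U>. open U \<and> bounded U \<and> diameter U \<le> r) \<and> E \<subseteq> \<Union>\<U>)"

definition assouad_dim :: "('a::euclidean_space) set \<Rightarrow> ereal" where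
  "assouad_dim F = Inf (ereal ` {\<sigma>. \<sigma> \<ge> 0 \<and>
     (\<exists>C>0. \<forall>R>0. \<forall>r\<in>{0<..<R}. \<forall>x\<in>F.
        real (covering_number (cball x R \<inter> F) r) \<le> C * (R / r) powr \<sigma>)})"

end

theory Submission
  imports Defs
begin

text \<open>
  The set is \<open>K = {0} \<union> (\<Union>j. Q\<^sub>j)\<close>, where the \<open>Q\<^sub>j\<close> are rescaled copies of the
  grids \<open>{\<Sum>w\<in>W. x\<^sub>w w | 0 \<le> x\<^sub>w < k}\<close>, one for every size \<open>k\<close> and every set \<open>W\<close> of
  at most \<open>m\<close> vectors from a fixed countable dense set.  The scales are chosen one after the
  other and decrease so fast that each grid fits into a ball around the origin whose radius
  is at most a third of the distance from the origin to the nonzero points of the preceding grid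
  (\<open>lacunary_scaling\<close>).

  Every orientation is reached because a grid moves only slightly when its orientation is
  replaced by a nearby set \<open>W\<close>, and a slight enough move keeps its finitely many points
  apart (\<open>grid_box_perturbation\<close>).  Rescaling keeps the error proportional to the scale, so
  the copy in \<open>K\<close> is the required approximate patch at whatever scale it was given.

  The upper bound for the dimension rests on each \<open>Q\<^sub>j\<close> lying in a subspace of dimension at most
  \<open>m\<close>: a subset of such a subspace in a ball of radius \<open>\<rho>\<close> is covered by \<open>C (\<rho>/r)\<^sup>m\<close> balls of
  radius \<open>r/2\<close>, with a constant that does not see how long or how nearly dependent the vectors
  of \<open>W\<close> are (\<open>subspace_ball_cover\<close>).  If a ball of radius \<open>R\<close> meets \<open>Q\<^sub>i - {0}\<close> and no earlier
  grid, lacunarity forces the later grids it meets to have radii at most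
  \<open>R, R/2, R/4, \<dots>\<close>, and since \<open>m \<ge> 1\<close> the corresponding bounds form a geometric series
  dominated by \<open>(R/r)\<^sup>m\<close> (\<open>lacunary_ball_cover\<close>).

  The lower bound holds for every bounded set that contains approximate patches of all sizes in an
  orthonormal orientation: the \<open>k\<^sup>m\<close> points near a patch of scale \<open>\<Delta>\<close> are separated by more
  than \<open>\<Delta>/3\<close> and lie in a ball of radius comparable to \<open>k \<Delta>\<close>, so that an admissible
  exponent \<open>\<sigma>\<close> satisfies \<open>k\<^sup>m \<le> c k\<^sup>\<sigma>\<close> for all \<open>k\<close> (\<open>assouad_dim_ge\<close>).
\<close>

section \<open>Coverings by balls\<close>

lemma covering_number_le_card:
  fixes A :: "'a::euclidean_space set"
  assumes T: "finite T" "A \<subseteq> (\<Union>c\<in>T. ball c (r/2))" and r: "0 < r"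
  shows "covering_number A r \<le> card T"
proof -
  let ?U = "(\<lambda>c. ball c (r/2)) ` T"
  have "covering_number A r \<le> card ?U"
    unfolding covering_number_def
  proof (rule Least_le, intro exI conjI)
    show "\<forall>U\<in>?U. open U \<and> bounded U \<and> diameter U \<le> r"
      using r by auto
  qed (use T in auto)
  also have "\<dots> \<le> card T" using T(1) by (rule card_image_le)
  finally show ?thesis .
qed

text \<open>Boundedness makes the set of cardinalities in the definition of the covering number
  nonempty; without this its \<open>LEAST\<close> would be an arbitrary number.\<close>

lemma covering_number_attained:
  fixes A :: "'a::euclidean_space set"
  assumes "bounded A" and r: "0 < r"
  obtains \<U> where "finite \<U>" "card \<U> = covering_number A r" "A \<subseteq> \<Union>\<U>"
    "\<And>U. U \<in> \<U> \<Longrightarrow> open U \<and> bounded U \<and> diameter U \<le> r"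
proof -
  have "compact (closure A)" using assms by simp
  then obtain T where T: "finite T" "closure A \<subseteq> (\<Union>c\<in>T. ball c (r/2))"
    using compact_imp_seq_compact seq_compact_imp_totally_bounded r
    by (metis half_gt_zero)
  let ?U = "(\<lambda>c. ball c (r/2)) ` T"
  have "finite ?U \<and> card ?U = card ?U \<and>
      (\<forall>U\<in>?U. open U \<and> bounded U \<and> diameter U \<le> r) \<and> A \<subseteq> \<Union>?U"
    using T r closure_subset[of A] by auto
  then have "\<exists>n \<U>. finite \<U> \<and> card \<U> = n \<and>
      (\<forall>U\<in>\<U>. open U \<and> bounded U \<and> diameter U \<le> r) \<and> A \<subseteq> \<Union>\<U>"
    by blast
  from LeastI_ex[OF this] show thesis
    unfolding covering_number_def[symmetric] using that by blast
qed

text \<open>Coordinates with respect to an orthonormal basis of the subspace identify it with a Euclidean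
  space of dimension at most \<open>m\<close>, where a cubical mesh of side comparable to \<open>r\<close> serves as the
  set of centres.  The constant depends on \<open>m\<close> only, not on the subspace; this uniformity is
  what allows infinitely many orientations in one set.\<close>

lemma subspace_ball_cover:
  fixes A V :: "'a::euclidean_space set"
  assumes V: "subspace V" "dim V \<le> m" and A: "A \<subseteq> V" "A \<subseteq> cball z \<rho>"
    and r: "0 < r" "r \<le> \<rho>"
  shows "\<exists>T. finite T \<and> real (card T) \<le> real (8 * m + 11) ^ m * (\<rho> / r) ^ m \<and>
    A \<subseteq> (\<Union>c\<in>T. ball c (r/2))"
proof (cases "A = {}")
  case True
  then show ?thesis using r by (intro exI[of _ "{}"]) auto
next
  case False
  then obtain p where p: "p \<in> A" by blast
  obtain B where B: "B \<subseteq> V" "pairwise orthogonal B" "\<And>b. b \<in> B \<Longrightarrow> norm b = 1"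
    "independent B" "card B = dim V" "span B = V"
    using orthonormal_basis_subspace[OF V(1)] by metis
  have finB: "finite B" using B(4) independent_imp_finite by blast
  \<comment> \<open>A mesh of side \<open>\<eta>\<close> is within \<open>m \<eta>\<close> of every point, and \<open>m + 1\<close> makes this
    strictly less than \<open>r/2\<close>, as the balls are open.\<close>
  define \<eta> where "\<eta> = r / (2 * real (m + 1))"
  define N where "N = \<lceil>2 * \<rho> / \<eta>\<rceil>"
  \<comment> \<open>The mesh is centred at a point of the set, as \<open>z\<close> may lie off the subspace; the
    radius doubles to \<open>2 \<rho>\<close> in exchange.\<close>
  define c where "c = (\<lambda>f :: 'a \<Rightarrow> int. p + (\<Sum>b\<in>B. (of_int (f b) * \<eta>) *\<^sub>R b))"
  define T where "T = c ` (B \<rightarrow>\<^sub>E {-N..N})"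
  have \<eta>: "\<eta> > 0" using r by (simp add: \<eta>_def)
  have q: "1 \<le> \<rho> / r" using r by simp
  have N0: "N \<ge> 0" using \<eta> r unfolding N_def
    by (metis divide_nonneg_pos less_imp_le mult_nonneg_nonneg order_trans
        zero_le_ceiling zero_le_numeral less_minus_one_simps(1) order_less_le_trans)
  have "finite T" using finB by (simp add: T_def finite_PiE)
  moreover have "real (card T) \<le> real (8 * m + 11) ^ m * (\<rho> / r) ^ m"
  proof -
    have "card T \<le> card (B \<rightarrow>\<^sub>E {-N..N})"
      unfolding T_def using finB by (intro card_image_le finite_PiE) auto
    also have "\<dots> = nat (2 * N + 1) ^ card B"
      using finB by (simp add: card_PiE algebra_simps)
    finally have "real (card T) \<le> real_of_int (2 * N + 1) ^ card B"
      using N0 by (metis of_nat_le_iff of_nat_power of_nat_nat add_nonneg_nonneg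
          mult_nonneg_nonneg zero_le_numeral zero_le_one of_int_of_nat_eq)
    also have "\<dots> \<le> real_of_int (2 * N + 1) ^ m"
      using B(5) V(2) N0 by (intro power_increasing) auto
    also have "\<dots> \<le> (real (8 * m + 11) * (\<rho> / r)) ^ m"
    proof (rule power_mono)
      have "2 * \<rho> / \<eta> = 4 * real (m + 1) * (\<rho> / r)"
        using r by (simp add: \<eta>_def field_simps)
      then have "real_of_int N \<le> 4 * real (m + 1) * (\<rho> / r) + 1"
        unfolding N_def by linarith
      moreover have "2 * (4 * real (m + 1) * x + 1) + 1 \<le> real (8 * m + 11) * x" if "1 \<le> x" for x
        using that by (simp add: algebra_simps)
      ultimately show "real_of_int (2 * N + 1) \<le> real (8 * m + 11) * (\<rho> / r)"
        using q by (smt (verit, best) of_int_add of_int_mult of_int_numeral of_int_1)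
    qed (use N0 in auto)
    finally show ?thesis by (simp only: power_mult_distrib)
  qed
  moreover have "A \<subseteq> (\<Union>c\<in>T. ball c (r/2))"
  proof
    fix y assume y: "y \<in> A"
    define f where "f = (\<lambda>b\<in>B. \<lfloor>(b \<bullet> (y - p)) / \<eta>\<rfloor>)"
    have yp: "norm (y - p) \<le> 2 * \<rho>"
    proof -
      have "dist z y \<le> \<rho>" "dist z p \<le> \<rho>" using A(2) y p by auto
      then show ?thesis using dist_triangle3[of y p z] by (simp add: dist_norm)
    qed
    have "f \<in> B \<rightarrow>\<^sub>E {-N..N}"
    proof
      fix b assume b: "b \<in> B"
      have "\<bar>b \<bullet> (y - p)\<bar> \<le> 2 * \<rho>"
        using Cauchy_Schwarz_ineq2[of b "y - p"] B(3)[OF b] yp by simp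
      then have "\<bar>(b \<bullet> (y - p)) / \<eta>\<bar> \<le> 2 * \<rho> / \<eta>"
        using \<eta> by (simp add: divide_right_mono)
      also have "\<dots> \<le> real_of_int N" unfolding N_def by simp
      finally have "\<bar>(b \<bullet> (y - p)) / \<eta>\<bar> \<le> real_of_int N" .
      then have "- real_of_int N \<le> (b \<bullet> (y - p)) / \<eta>" "(b \<bullet> (y - p)) / \<eta> \<le> real_of_int N"
        by linarith+
      then have "- N \<le> \<lfloor>(b \<bullet> (y - p)) / \<eta>\<rfloor>" "\<lfloor>(b \<bullet> (y - p)) / \<eta>\<rfloor> \<le> N"
        by (simp_all add: le_floor_iff floor_le_iff)
      then show "f b \<in> {-N..N}" using b by (simp add: f_def)
    qed (auto simp: f_def)
    then have "c f \<in> T" by (simp add: T_def)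
    moreover have "dist (c f) y < r/2"
    proof -
      have "y - p \<in> span B" using A(1) y p B(6) V(1) by (auto intro: subspace_diff)
      from orthonormal_basis_expand[OF B(2,3) this finB]
      have "y - p = (\<Sum>b\<in>B. (b \<bullet> (y - p)) *\<^sub>R b)"
        by (simp only: inner_commute[of _ "y - p"])
      then have "y - c f = (\<Sum>b\<in>B. (b \<bullet> (y - p)) *\<^sub>R b) - (\<Sum>b\<in>B. (of_int (f b) * \<eta>) *\<^sub>R b)"
        by (simp add: c_def algebra_simps)
      also have "\<dots> = (\<Sum>b\<in>B. (b \<bullet> (y - p) - of_int (f b) * \<eta>) *\<^sub>R b)"
        by (simp add: sum_subtractf scaleR_diff_left)
      finally have "norm (y - c f) \<le> (\<Sum>b\<in>B. norm ((b \<bullet> (y - p) - of_int (f b) * \<eta>) *\<^sub>R b))"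
        by (simp only: norm_sum)
      also have "\<dots> \<le> (\<Sum>b\<in>B. \<eta>)"
      proof (rule sum_mono)
        fix b assume b: "b \<in> B"
        let ?u = "(b \<bullet> (y - p)) / \<eta>"
        have "b \<bullet> (y - p) - of_int (f b) * \<eta> = (?u - of_int \<lfloor>?u\<rfloor>) * \<eta>"
          using \<eta> b by (simp add: f_def left_diff_distrib)
        then have "\<bar>b \<bullet> (y - p) - of_int (f b) * \<eta>\<bar> = \<bar>?u - of_int \<lfloor>?u\<rfloor>\<bar> * \<eta>"
          using \<eta> by (simp only: abs_mult abs_of_pos)
        also have "\<dots> \<le> 1 * \<eta>"
          using \<eta> by (intro mult_right_mono) (auto, linarith)
        finally show "norm ((b \<bullet> (y - p) - of_int (f b) * \<eta>) *\<^sub>R b) \<le> \<eta>"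
          using B(3)[OF b] by simp
      qed
      also have "\<dots> \<le> real m * \<eta>" using B(5) V(2) \<eta> by (simp add: mult_right_mono)
      also have "\<dots> < r/2" using r by (simp add: \<eta>_def field_simps)
      finally show ?thesis by (simp add: dist_norm norm_minus_commute)
    qed
    ultimately show "y \<in> (\<Union>c\<in>T. ball c (r/2))" by auto
  qed
  ultimately show ?thesis by blast
qed


section \<open>Lacunary unions\<close>

text \<open>A member of an open cover that contains \<open>0\<close> already contains all but finitely many of the finite
  pieces.\<close>

lemma compact_shrinking_union:
  fixes Q :: "nat \<Rightarrow> 'a::euclidean_space set"
  assumes fin: "\<And>j. finite (Q j)" and Q: "\<And>j. Q j \<subseteq> cball 0 (\<delta> j)" and \<delta>: "\<delta> \<longlonglongrightarrow> 0"
  shows "compact (insert 0 (\<Union>j. Q j))"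
proof (rule compactI)
  fix \<C> :: "'a set set"
  assume op: "\<forall>U\<in>\<C>. open U" and cov: "insert 0 (\<Union>j. Q j) \<subseteq> \<Union>\<C>"
  then obtain U where U: "U \<in> \<C>" "0 \<in> U" "open U" by blast
  then obtain e where e: "e > 0" "ball 0 e \<subseteq> U" using openE by blast
  obtain J where J: "\<And>j. j \<ge> J \<Longrightarrow> \<delta> j < e"
    using order_tendstoD(2)[OF \<delta> e(1)] unfolding eventually_sequentially by blast
  have "compact (\<Union>j<J. Q j)" using fin by (intro finite_imp_compact) auto
  moreover have "(\<Union>j<J. Q j) \<subseteq> \<Union>\<C>" using cov by auto
  ultimately obtain \<D> where D: "\<D> \<subseteq> \<C>" "finite \<D>" "(\<Union>j<J. Q j) \<subseteq> \<Union>\<D>"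
    using op by (metis compactE)
  have "insert 0 (\<Union>j. Q j) \<subseteq> \<Union>(insert U \<D>)"
  proof -
    have "y \<in> \<Union>(insert U \<D>)" if "y \<in> Q j" for y j
    proof (cases "j < J")
      case True
      then show ?thesis using D(3) that by blast
    next
      case False
      then have "norm y < e" using Q[of j] J[of j] that by force
      then show ?thesis using e(2) by auto
    qed
    then show ?thesis using U(2) by blast
  qed
  then show "\<exists>\<C>'\<subseteq>\<C>. finite \<C>' \<and> insert 0 (\<Union>j. Q j) \<subseteq> \<Union>\<C>'"
    using D U(1) by (intro exI[of _ "insert U \<D>"]) auto
qed

text \<open>The balls are counted piece by piece.  The first piece \<open>Q i\<close> met by \<open>cball x R\<close> costs a multiple
  of \<open>(R/r)\<^sup>m\<close>.  If a later piece is met as well, the ball contains a point of norm at least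
  \<open>3 \<delta> (Suc i)\<close> and one of norm at most \<open>\<delta> (Suc i)\<close>, so \<open>\<delta> (Suc i) \<le> R\<close>, and the
  \<open>l\<close>-th piece after \<open>Q i\<close> has radius at most \<open>2 R / 2\<^sup>l\<close>.  Pieces of radius below \<open>r/2\<close>
  share one ball around the origin, and the costs of the others form a geometric series because
  \<open>m \<ge> 1\<close>.\<close>

lemma lacunary_ball_cover:
  fixes Q V :: "nat \<Rightarrow> 'a::euclidean_space set"
  assumes V: "\<And>j. subspace (V j)" "\<And>j. dim (V j) \<le> m" "\<And>j. Q j \<subseteq> V j"
    and Q: "\<And>j. Q j \<subseteq> cball 0 (\<delta> j)" "\<And>j y. y \<in> Q j \<Longrightarrow> 3 * \<delta> (Suc j) \<le> norm y"
    and \<delta>: "\<And>j. 0 < \<delta> j" "\<And>j. \<delta> (Suc j) \<le> \<delta> j / 2"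
    and m: "1 \<le> m" and r: "0 < r" "r < R"
  shows "\<exists>T. finite T \<and> real (card T) \<le> (2 * real (8 * m + 11) ^ m * 4 ^ m + 1) * (R / r) ^ m \<and>
    cball x R \<inter> insert 0 (\<Union>j. Q j) \<subseteq> (\<Union>c\<in>T. ball c (r/2))"
proof (cases "\<exists>j. Q j \<inter> cball x R \<noteq> {}")
  case False
  have "1 \<le> (R / r) ^ m" using r by (intro one_le_power) simp
  moreover have "1 \<le> 2 * real (8 * m + 11) ^ m * 4 ^ m + 1" by simp
  ultimately have "1 * 1 \<le> (2 * real (8 * m + 11) ^ m * 4 ^ m + 1) * (R / r) ^ m"
    by (intro mult_mono) auto
  then show ?thesis using False r by (intro exI[of _ "{0}"]) auto
next
  case True
  define i where "i = (LEAST j. Q j \<inter> cball x R \<noteq> {})"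
  have i: "Q i \<inter> cball x R \<noteq> {}" and least: "\<And>j. Q j \<inter> cball x R \<noteq> {} \<Longrightarrow> i \<le> j"
    using True unfolding i_def by (metis (mono_tags, lifting) LeastI_ex, metis (mono_tags, lifting) Least_le)
  then obtain p where p: "p \<in> Q i" "dist x p \<le> R" by auto
  define A where "A = (\<lambda>l. Q (i + l) \<inter> cball x R)"
  have \<delta>_geo: "\<delta> (Suc i + l) \<le> \<delta> (Suc i) / 2 ^ l" for l
  proof (induction l)
    case (Suc l)
    have "\<delta> (Suc i + Suc l) \<le> \<delta> (Suc i + l) / 2" using \<delta>(2)[of "Suc i + l"] by simp
    with Suc show ?case by simp
  qed simp
  have A_small: "A (Suc l) \<subseteq> cball 0 (2 * R / 2 ^ Suc l)" for l
  proof
    fix y assume y: "y \<in> A (Suc l)"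
    have yn: "norm y \<le> \<delta> (Suc i) / 2 ^ l"
      using y Q(1)[of "i + Suc l"] \<delta>_geo[of l] by (force simp: A_def)
    also have "\<dots> \<le> \<delta> (Suc i)" using \<delta>(1)[of "Suc i"] by (simp add: divide_le_eq mult_left_le)
    finally have "2 * \<delta> (Suc i) \<le> norm p - norm y" using Q(2)[OF p(1)] by simp
    also have "\<dots> \<le> dist y p"
      by (metis dist_norm norm_minus_commute norm_triangle_ineq2)
    also have "\<dots> \<le> 2 * R"
      using dist_triangle3[of y p x] y p(2) by (auto simp: A_def)
    finally have "\<delta> (Suc i) \<le> R" by simp
    then have "\<delta> (Suc i) / 2 ^ l \<le> R / 2 ^ l" by (simp add: divide_right_mono)
    with yn show "y \<in> cball 0 (2 * R / 2 ^ Suc l)" by simp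
  qed
  have A_ball: "\<exists>z. A l \<subseteq> cball z (4 * R / 2 ^ l)" for l
  proof (cases l)
    case 0
    have "A 0 \<subseteq> cball x (4 * R / 2 ^ 0)" using r by (auto simp: A_def)
    then show ?thesis using 0 by blast
  next
    case (Suc k)
    have "2 * R / 2 ^ Suc k \<le> 4 * R / 2 ^ Suc k" using r by (intro divide_right_mono) auto
    then have "A l \<subseteq> cball 0 (4 * R / 2 ^ l)"
      using A_small[of k] Suc by (meson order_trans subset_cball)
    then show ?thesis by blast
  qed
  \<comment> \<open>From index \<open>L\<close> on, all pieces fit into the single ball \<open>ball 0 (r/2)\<close>; before \<open>L\<close> the
    radius \<open>4 R / 2\<^sup>l\<close> is at least \<open>r\<close>, as the covering lemma for subspaces requires.\<close>
  define L where "L = (LEAST l. 4 * R / 2 ^ l < r)"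
  have "\<exists>l. 4 * R / 2 ^ l < r"
  proof -
    obtain l where "4 * R / r < 2 ^ l" using real_arch_pow[of 2 "4 * R / r"] by auto
    then show ?thesis using r by (intro exI[of _ l]) (simp add: field_simps)
  qed
  then have L: "4 * R / 2 ^ L < r" unfolding L_def by (rule LeastI_ex)
  have beforeL: "r \<le> 4 * R / 2 ^ l" if "l < L" for l
    using not_less_Least that unfolding L_def by (meson not_le)
  have L0: "L \<noteq> 0" using L r by (intro notI) auto
  define C where "C = real (8 * m + 11) ^ m"
  have "\<exists>T. finite T \<and> real (card T) \<le> C * ((4 * R / 2 ^ l) / r) ^ m \<and>
      A l \<subseteq> (\<Union>c\<in>T. ball c (r/2))" if l: "l < L" for l
  proof -
    obtain z where "A l \<subseteq> cball z (4 * R / 2 ^ l)" using A_ball by blast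
    moreover have "A l \<subseteq> V (i + l)" using V(3) by (auto simp: A_def)
    ultimately show ?thesis
      using subspace_ball_cover V(1,2) beforeL[OF l] r(1) unfolding C_def by metis
  qed
  then obtain T where T: "\<And>l. l < L \<Longrightarrow> finite (T l)"
    "\<And>l. l < L \<Longrightarrow> real (card (T l)) \<le> C * ((4 * R / 2 ^ l) / r) ^ m"
    "\<And>l. l < L \<Longrightarrow> A l \<subseteq> (\<Union>c\<in>T l. ball c (r/2))"
    by metis
  let ?T = "insert 0 (\<Union>l<L. T l)"
  have "real (card ?T) \<le> (2 * C * 4 ^ m + 1) * (R / r) ^ m"
  proof -
    have C: "C \<ge> 0" by (simp add: C_def)
    have "card ?T \<le> card (\<Union>l<L. T l) + 1"
      using T(1) by (simp add: card_insert_if)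
    also have "\<dots> \<le> (\<Sum>l<L. card (T l)) + 1" by (simp add: card_UN_le)
    finally have "real (card ?T) \<le> real ((\<Sum>l<L. card (T l)) + 1)" by (rule of_nat_mono)
    then have "real (card ?T) \<le> (\<Sum>l<L. real (card (T l))) + 1"
      by (simp only: of_nat_add of_nat_sum of_nat_1)
    also have "(\<Sum>l<L. real (card (T l))) \<le> (\<Sum>l<L. C * 4 ^ m * (R / r) ^ m * (1/2) ^ l)"
    proof (rule sum_mono)
      fix l assume l: "l \<in> {..<L}"
      have "(((1/2) ^ l) ^ m :: real) \<le> ((1/2) ^ l) ^ 1"
        using m by (intro power_decreasing) (auto simp: power_le_one)
      then have half: "(((1/2) ^ l) ^ m :: real) \<le> (1/2) ^ l" by simp
      have "(4 * R / 2 ^ l) / r = 4 * (R / r) * (1/2) ^ l"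
        by (simp add: power_divide)
      then have "C * ((4 * R / 2 ^ l) / r) ^ m = C * 4 ^ m * (R / r) ^ m * ((1/2) ^ l) ^ m"
        by (simp only: power_mult_distrib mult_ac)
      also have "\<dots> \<le> C * 4 ^ m * (R / r) ^ m * (1/2) ^ l"
        using half C r by (intro mult_left_mono) auto
      finally show "real (card (T l)) \<le> C * 4 ^ m * (R / r) ^ m * (1/2) ^ l"
        using T(2) l by force
    qed
    also have "\<dots> = C * 4 ^ m * (R / r) ^ m * (\<Sum>l<L. (1/2) ^ l)"
      by (simp add: sum_distrib_left)
    also have "\<dots> \<le> C * 4 ^ m * (R / r) ^ m * 2"
      using C r by (intro mult_left_mono) (auto simp: sum_gp_strict)
    finally have "real (card ?T) \<le> C * 4 ^ m * (R / r) ^ m * 2 + 1" by simp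
    moreover have "1 \<le> (R / r) ^ m" using r by (intro one_le_power) simp
    ultimately show ?thesis by (simp add: algebra_simps)
  qed
  moreover have "cball x R \<inter> insert 0 (\<Union>j. Q j) \<subseteq> (\<Union>c\<in>?T. ball c (r/2))"
  proof
    fix y assume y: "y \<in> cball x R \<inter> insert 0 (\<Union>j. Q j)"
    show "y \<in> (\<Union>c\<in>?T. ball c (r/2))"
    proof (cases "y = 0")
      case True
      then show ?thesis using r by auto
    next
      case False
      then obtain j where j: "y \<in> Q j" "y \<in> cball x R" using y by blast
      then have "i \<le> j" using least by blast
      then obtain l where l: "j = i + l" using le_Suc_ex by blast
      have yA: "y \<in> A l" using j l by (simp add: A_def)
      show ?thesis
      proof (cases "l < L")
        case True
        then show ?thesis using T(3) yA by blast
      next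
        case False
        then obtain k where k: "l = Suc k" using L0 by (cases l) auto
        have "norm y \<le> 2 * R / 2 ^ l" using A_small[of k] yA k by force
        also have "\<dots> \<le> 2 * R / 2 ^ L"
          using False r by (intro divide_left_mono power_increasing) auto
        also have "\<dots> < r / 2" using L by simp
        finally show ?thesis by auto
      qed
    qed
  qed
  moreover have "finite ?T" using T(1) by auto
  ultimately show ?thesis unfolding C_def by blast
qed

text \<open>If the norms of the nonzero points of \<open>S j\<close> lie between \<open>\<mu> j\<close> and \<open>M j\<close>, then scaling
  by \<open>\<delta> j / M j\<close> puts \<open>S j\<close> into the ball of radius \<open>\<delta> j\<close> and keeps its nonzero points at
  distance at least \<open>\<delta> j * \<mu> j / M j\<close> from the origin.  The admissible ratio of successive radii
  therefore depends on \<open>S j\<close> alone, so the radii are plain products of these ratios.\<close>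

lemma lacunary_scaling:
  fixes S :: "nat \<Rightarrow> 'a::euclidean_space set"
  assumes fin: "\<And>j. finite (S j)"
  obtains \<delta> scale :: "nat \<Rightarrow> real"
  where "\<And>j. 0 < scale j" "\<And>j. 0 < \<delta> j" "\<And>j. \<delta> (Suc j) \<le> \<delta> j / 2" "\<delta> \<longlonglongrightarrow> 0"
    "\<And>j s. s \<in> S j \<Longrightarrow> norm (scale j *\<^sub>R s) \<le> \<delta> j"
    "\<And>j s. s \<in> S j \<Longrightarrow> s \<noteq> 0 \<Longrightarrow> 3 * \<delta> (Suc j) \<le> norm (scale j *\<^sub>R s)"
proof -
  have "\<exists>M>0. \<forall>s\<in>S j. norm s \<le> M" for j
    using finite_imp_bounded[OF fin] bounded_pos by metis
  then obtain M where M: "\<And>j. M j > 0" "\<And>j s. s \<in> S j \<Longrightarrow> norm s \<le> M j" by metis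
  have "\<exists>\<mu>>0. \<forall>s\<in>S j. s \<noteq> 0 \<longrightarrow> \<mu> \<le> norm s" for j
    using finite_set_avoid[OF fin, of j 0] by simp
  then obtain \<mu> where \<mu>: "\<And>j. \<mu> j > 0" "\<And>j s. s \<in> S j \<Longrightarrow> s \<noteq> 0 \<Longrightarrow> \<mu> j \<le> norm s" by metis
  define c where "c = (\<lambda>j. min (1/2) (\<mu> j / (3 * M j)))"
  define \<delta> where "\<delta> = (\<lambda>j. \<Prod>i<j. c i)"
  define scale where "scale = (\<lambda>j. \<delta> j / M j)"
  have c: "0 < c j" for j using M(1) \<mu>(1) by (simp add: c_def)
  then have \<delta>: "0 < \<delta> j" for j by (simp add: \<delta>_def prod_pos)
  have scale: "0 < scale j" for j using \<delta> M(1) by (simp add: scale_def)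
  have \<delta>S: "\<delta> (Suc j) = \<delta> j * c j" for j by (simp add: \<delta>_def)
  have half: "\<delta> (Suc j) \<le> \<delta> j / 2" for j
  proof -
    have "\<delta> j * c j \<le> \<delta> j * (1/2)" using \<delta>[of j] by (intro mult_left_mono) (auto simp: c_def)
    then show ?thesis by (simp add: \<delta>S)
  qed
  have "\<delta> j \<le> (1/2) ^ j" for j
  proof (induction j)
    case (Suc j)
    then show ?case using half[of j] by simp
  qed (simp add: \<delta>_def)
  then have lim: "\<delta> \<longlonglongrightarrow> 0"
    using \<delta> LIMSEQ_power_zero[of "1/2 :: real"]
    by (intro tendsto_sandwich[of "\<lambda>_. 0" \<delta> sequentially "\<lambda>j. (1/2) ^ j"])
      (auto intro!: always_eventually less_imp_le)
  have upper: "norm (scale j *\<^sub>R s) \<le> \<delta> j" if "s \<in> S j" for j s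
  proof -
    have "scale j * norm s \<le> scale j * M j"
      using M(2)[OF that] scale[of j] by (intro mult_left_mono) auto
    then show ?thesis using M(1)[of j] \<delta>[of j] by (simp add: scale_def)
  qed
  have lower: "3 * \<delta> (Suc j) \<le> norm (scale j *\<^sub>R s)" if "s \<in> S j" "s \<noteq> 0" for j s
  proof -
    have "\<delta> (Suc j) \<le> \<delta> j * (\<mu> j / (3 * M j))"
      unfolding \<delta>S using \<delta>[of j] by (intro mult_left_mono) (auto simp: c_def)
    then have "3 * \<delta> (Suc j) \<le> scale j * \<mu> j" by (simp add: scale_def)
    also have "\<dots> \<le> scale j * norm s" using \<mu>(2)[OF that] scale[of j] by (intro mult_left_mono) auto
    finally show ?thesis using scale[of j] by simp
  qed
  show thesis using that[of scale \<delta>, OF scale \<delta> half lim upper lower] by blast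
qed

section \<open>Perturbing the orientation of a grid\<close>

text \<open>The arithmetic patch of scale \<open>1\<close> based at the origin.\<close>

definition grid_box :: "nat \<Rightarrow> 'a::euclidean_space set \<Rightarrow> 'a set" where
  "grid_box k E = {\<Sum>e\<in>E. real (x e) *\<^sub>R e |x. \<forall>e\<in>E. x e < k}"

text \<open>Indexing the grid of the moved orientation by the coefficient functions on \<open>E\<close> makes it
  comparable, point by point, with the grid of \<open>E\<close>.\<close>

lemma grid_box_image:
  assumes "inj_on v E"
  shows "grid_box k (v ` E) = (\<lambda>x. \<Sum>e\<in>E. real (x e) *\<^sub>R v e) ` (E \<rightarrow>\<^sub>E {..<k})"
proof (intro set_eqI iffI)
  fix z assume "z \<in> grid_box k (v ` E)"
  then obtain x where x: "z = (\<Sum>w\<in>v ` E. real (x w) *\<^sub>R w)" "\<forall>w\<in>v ` E. x w < k"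
    by (auto simp: grid_box_def)
  have "z = (\<Sum>e\<in>E. real (restrict (x \<circ> v) E e) *\<^sub>R v e)"
    using x(1) by (simp add: sum.reindex[OF assms])
  moreover have "restrict (x \<circ> v) E \<in> E \<rightarrow>\<^sub>E {..<k}" using x(2) by auto
  ultimately show "z \<in> (\<lambda>x. \<Sum>e\<in>E. real (x e) *\<^sub>R v e) ` (E \<rightarrow>\<^sub>E {..<k})" by blast
next
  fix z assume "z \<in> (\<lambda>x. \<Sum>e\<in>E. real (x e) *\<^sub>R v e) ` (E \<rightarrow>\<^sub>E {..<k})"
  then obtain x where x: "z = (\<Sum>e\<in>E. real (x e) *\<^sub>R v e)" "x \<in> E \<rightarrow>\<^sub>E {..<k}" by blast
  let ?y = "x \<circ> inv_into E v"
  have "z = (\<Sum>w\<in>v ` E. real (?y w) *\<^sub>R w)"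
    using x(1) assms by (simp add: sum.reindex[OF assms])
  moreover have "\<forall>w\<in>v ` E. ?y w < k" using x(2) assms by auto
  ultimately show "z \<in> grid_box k (v ` E)" unfolding grid_box_def by blast
qed

lemma grid_box_eq_image:
  "grid_box k E = (\<lambda>x. \<Sum>e\<in>E. real (x e) *\<^sub>R e) ` (E \<rightarrow>\<^sub>E {..<k})"
  using grid_box_image[of "\<lambda>e. e" E k] by simp

lemma finite_grid_box: "finite E \<Longrightarrow> finite (grid_box k E)"
  by (simp add: grid_box_eq_image finite_PiE)

lemma grid_box_subset_span: "grid_box k E \<subseteq> span E"
  by (auto simp: grid_box_def intro!: span_sum intro: span_scale span_base)

lemma arithmetic_patch_grid_box:
  "arithmetic_patch k \<Delta> E ((*\<^sub>R) \<Delta> ` grid_box k E)"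
  unfolding arithmetic_patch_def grid_box_def by (intro exI[of _ 0]) auto

lemma inj_on_independent_combination:
  assumes "independent E"
  shows "inj_on (\<lambda>x :: 'a::euclidean_space \<Rightarrow> nat. \<Sum>e\<in>E. real (x e) *\<^sub>R e) (E \<rightarrow>\<^sub>E X)"
proof (rule inj_onI)
  fix x y :: "'a \<Rightarrow> nat"
  assume xy: "x \<in> E \<rightarrow>\<^sub>E X" "y \<in> E \<rightarrow>\<^sub>E X"
    and eq: "(\<Sum>e\<in>E. real (x e) *\<^sub>R e) = (\<Sum>e\<in>E. real (y e) *\<^sub>R e)"
  have fin: "finite E" using assms independent_imp_finite by blast
  have "(\<Sum>e\<in>E. (real (x e) - real (y e)) *\<^sub>R e) = 0"
    using eq by (simp add: scaleR_diff_left sum_subtractf)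
  then have "real (x e) - real (y e) = 0" if "e \<in> E" for e
    using independentD[OF assms fin subset_refl, of "\<lambda>e. real (x e) - real (y e)"] that by blast
  then show "x = y" using xy by (intro PiE_ext) auto
qed

lemma finite_separated:
  fixes S :: "'a::metric_space set"
  assumes "finite S"
  obtains s where "s > 0" "\<And>x y. x \<in> S \<Longrightarrow> y \<in> S \<Longrightarrow> x \<noteq> y \<Longrightarrow> s \<le> dist x y"
proof -
  have "finite ((\<lambda>(x, y). dist x y) ` (S \<times> S))" using assms by simp
  from finite_set_avoid[OF this, of 0] show thesis using that by fastforce
qed

text \<open>Moving each vector of \<open>E\<close> by less than \<open>\<eta>\<close> moves each grid point by at most
  \<open>k (card E) \<eta>\<close>.  Once this is at most a third of the least distance between grid points, moved points
  stay distinct, so the grid keeps its cardinality.\<close>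

lemma grid_box_perturbation:
  fixes E D :: "'a::euclidean_space set"
  assumes E: "independent E" and \<epsilon>: "0 < \<epsilon>"
    and D: "\<And>X. open X \<Longrightarrow> X \<noteq> {} \<Longrightarrow> \<exists>d\<in>D. d \<in> X"
  obtains W where "W \<subseteq> D" "finite W" "card W = card E"
    "card (grid_box k W) = card (grid_box k E)"
    "\<And>x. x \<in> grid_box k E \<Longrightarrow> \<exists>y\<in>grid_box k W. norm (x - y) \<le> \<epsilon>"
proof -
  have fin: "finite E" using E independent_imp_finite by blast
  \<comment> \<open>Including \<open>E\<close> itself in the separated set keeps the moved vectors distinct too.\<close>
  obtain s where s: "s > 0"
    "\<And>x y. x \<in> grid_box k E \<union> E \<Longrightarrow> y \<in> grid_box k E \<union> E \<Longrightarrow> x \<noteq> y \<Longrightarrow> s \<le> dist x y"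
    using finite_separated[of "grid_box k E \<union> E"] fin finite_grid_box by (metis finite_UnI)
  define \<gamma> where "\<gamma> = min \<epsilon> (s / 3)"
  define \<eta> where "\<eta> = \<gamma> / (real k * real (card E) + 1)"
  have \<gamma>: "\<gamma> > 0" "\<gamma> \<le> \<epsilon>" "\<gamma> \<le> s / 3" using \<epsilon> s(1) by (auto simp: \<gamma>_def)
  have \<eta>: "\<eta> > 0" "\<eta> \<le> \<gamma>" using \<gamma>(1) by (auto simp: \<eta>_def divide_le_eq add_pos_nonneg add_nonneg_pos)
  have k\<eta>: "real k * real (card E) * \<eta> \<le> \<gamma>"
    using \<gamma>(1) by (simp add: \<eta>_def divide_le_eq add_nonneg_pos)
  have "\<forall>e. \<exists>d\<in>D. d \<in> ball e \<eta>" using D[of "ball _ \<eta>"] \<eta>(1) by auto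
  then obtain v where v: "\<And>e. v e \<in> D" "\<And>e. dist e (v e) < \<eta>" by (metis mem_ball)
  have inj: "inj_on v E"
  proof (rule inj_onI, rule ccontr)
    fix e f assume ef: "e \<in> E" "f \<in> E" "v e = v f" "e \<noteq> f"
    have "dist e f < 2 * \<eta>" using v(2)[of e] v(2)[of f] dist_triangle2[of e f "v e"] ef(3) by simp
    moreover have "s \<le> dist e f" using s(2) ef by auto
    ultimately show False using \<eta> \<gamma> by simp
  qed
  define a where "a = (\<lambda>x :: 'a \<Rightarrow> nat. \<Sum>e\<in>E. real (x e) *\<^sub>R e)"
  define b where "b = (\<lambda>x :: 'a \<Rightarrow> nat. \<Sum>e\<in>E. real (x e) *\<^sub>R v e)"
  let ?X = "E \<rightarrow>\<^sub>E {..<k}"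
  have close: "norm (a x - b x) \<le> \<gamma>" if x: "x \<in> ?X" for x
  proof -
    have "a x - b x = (\<Sum>e\<in>E. real (x e) *\<^sub>R (e - v e))"
      by (simp add: a_def b_def scaleR_diff_right sum_subtractf)
    then have "norm (a x - b x) \<le> (\<Sum>e\<in>E. norm (real (x e) *\<^sub>R (e - v e)))"
      by (simp only: norm_sum)
    also have "\<dots> \<le> (\<Sum>e\<in>E. real k * \<eta>)"
    proof (rule sum_mono)
      fix e assume "e \<in> E"
      then have "real (x e) \<le> real k" using x by (auto dest: PiE_mem)
      moreover have "norm (e - v e) \<le> \<eta>" using v(2)[of e] by (simp add: dist_norm)
      ultimately show "norm (real (x e) *\<^sub>R (e - v e)) \<le> real k * \<eta>"
        by (simp add: mult_mono)
    qed
    also have "\<dots> \<le> \<gamma>" using k\<eta> by (simp add: algebra_simps)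
    finally show ?thesis .
  qed
  have PE: "grid_box k E = a ` ?X" unfolding a_def by (rule grid_box_eq_image)
  have PW: "grid_box k (v ` E) = b ` ?X" unfolding b_def by (rule grid_box_image[OF inj])
  have inja: "inj_on a ?X" unfolding a_def by (rule inj_on_independent_combination[OF E])
  have injb: "inj_on b ?X"
  proof (rule inj_onI, rule ccontr)
    fix x y assume xy: "x \<in> ?X" "y \<in> ?X" "b x = b y" "x \<noteq> y"
    then have "a x \<noteq> a y" using inja by (meson inj_onD)
    then have "s \<le> dist (a x) (a y)" using s(2) xy PE by auto
    also have "\<dots> \<le> dist (a x) (b x) + dist (a y) (b x)" by (rule dist_triangle2)
    also have "\<dots> \<le> 2 * \<gamma>" using close xy by (simp add: dist_norm) (metis add_mono mult_2)
    finally show False using \<gamma> by simp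
  qed
  show thesis
  proof
    show "v ` E \<subseteq> D" using v by auto
    show "finite (v ` E)" using fin by simp
    show "card (v ` E) = card E" using inj by (rule card_image)
    show "card (grid_box k (v ` E)) = card (grid_box k E)"
      by (simp add: PE PW card_image inja injb)
    show "\<exists>y\<in>grid_box k (v ` E). norm (x - y) \<le> \<epsilon>" if x: "x \<in> grid_box k E" for x
    proof -
      obtain u where u: "u \<in> ?X" "x = a u" using x unfolding PE by blast
      then have "norm (x - b u) \<le> \<epsilon>" using close[OF u(1)] \<gamma>(2) by simp
      then show ?thesis using u(1) unfolding PW by blast
    qed
  qed
qed

text \<open>The error allowed in an approximate patch is proportional to its scale, so a perturbed grid
  may be shrunk by any factor without losing the property.\<close>

lemma is_AP_scaled_grid_box:
  fixes E W :: "'a::euclidean_space set"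
  assumes "0 < \<Delta>" "finite W" "card (grid_box k W) = card (grid_box k E)"
    and close: "\<And>x. x \<in> grid_box k E \<Longrightarrow> \<exists>y\<in>grid_box k W. norm (x - y) \<le> \<epsilon>"
  shows "is_AP k \<epsilon> E ((*\<^sub>R) \<Delta> ` grid_box k W)"
  unfolding is_AP_def
proof (intro exI conjI)
  show "0 < \<Delta>" by fact
  show "arithmetic_patch k \<Delta> E ((*\<^sub>R) \<Delta> ` grid_box k E)" by (rule arithmetic_patch_grid_box)
  show "finite ((*\<^sub>R) \<Delta> ` grid_box k W)" using assms(2) finite_grid_box by blast
  show "card ((*\<^sub>R) \<Delta> ` grid_box k W) = card ((*\<^sub>R) \<Delta> ` grid_box k E)"
    using assms(1,3) by (simp add: card_image inj_on_def)
  show "\<forall>x\<in>(*\<^sub>R) \<Delta> ` grid_box k E. (INF y\<in>(*\<^sub>R) \<Delta> ` grid_box k W. norm (x - y)) \<le> \<epsilon> * \<Delta>"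
  proof
    fix x assume "x \<in> (*\<^sub>R) \<Delta> ` grid_box k E"
    then obtain x' where x': "x = \<Delta> *\<^sub>R x'" "x' \<in> grid_box k E" by blast
    then obtain y where y: "y \<in> grid_box k W" "norm (x' - y) \<le> \<epsilon>" using close by blast
    have "norm (x - \<Delta> *\<^sub>R y) = \<Delta> * norm (x' - y)"
      using assms(1) x'(1) by (simp flip: scaleR_diff_right)
    also have "\<dots> \<le> \<epsilon> * \<Delta>" using y(2) assms(1) by simp
    finally have "norm (x - \<Delta> *\<^sub>R y) \<le> \<epsilon> * \<Delta>" .
    then show "(INF y\<in>(*\<^sub>R) \<Delta> ` grid_box k W. norm (x - y)) \<le> \<epsilon> * \<Delta>"
      using y(1) by (intro cINF_lower2[of _ _ "\<Delta> *\<^sub>R y"]) (auto intro!: bdd_belowI[of _ 0])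
  qed
qed

section \<open>Arithmetic progressions bound the Assouad dimension below\<close>

text \<open>Points of a patch with orthonormal orientation are at least \<open>\<Delta>\<close> apart.  Each has a
  point of \<open>Q\<close> within less than \<open>\<Delta>/3\<close>, so no set of diameter at most \<open>\<Delta>/3\<close> can contain the
  companions of two different patch points, and a cover needs one set for each of the
  \<open>k\<^bsup>card E\<^esup>\<close> points.\<close>

lemma AP_covering_number:
  fixes E Q K :: "'a::euclidean_space set"
  assumes E: "E \<subseteq> Basis" "1 \<le> card E" and k: "1 \<le> k"
    and AP: "is_AP k (1/4) E Q" and Q: "Q \<subseteq> K" and K: "bounded K"
  obtains \<Delta> y where "0 < \<Delta>" "y \<in> K"
    "k ^ card E \<le> covering_number (cball y (2 * \<Delta> * real (k * card E)) \<inter> K) (\<Delta> / 3)"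
proof -
  have fin: "finite E" by (rule finite_subset[OF E(1) finite_Basis])
  obtain \<Delta> P where \<Delta>: "0 < \<Delta>" and card: "card Q = card P"
    and patch: "arithmetic_patch k \<Delta> E P"
    and near: "\<forall>x\<in>P. (INF y\<in>Q. norm (x - y)) \<le> 1/4 * \<Delta>"
    using AP by (auto simp: is_AP_def)
  obtain t where P: "P = {t + \<Delta> *\<^sub>R (\<Sum>e\<in>E. real (x e) *\<^sub>R e) |x :: 'a \<Rightarrow> nat. \<forall>e\<in>E. x e < k}"
    using patch unfolding arithmetic_patch_def by (elim exE)
  let ?X = "E \<rightarrow>\<^sub>E {..<k}"
  define p where "p = (\<lambda>x :: 'a \<Rightarrow> nat. t + \<Delta> *\<^sub>R (\<Sum>e\<in>E. real (x e) *\<^sub>R e))"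
  have P': "P = (\<lambda>z. t + \<Delta> *\<^sub>R z) ` grid_box k E" unfolding P grid_box_def by auto
  have PX: "P = p ` ?X" unfolding P' grid_box_eq_image p_def by (simp add: image_image)
  have finX: "finite ?X" using fin by (simp add: finite_PiE)
  define x0 where "x0 = (\<lambda>e\<in>E. 0 :: nat)"
  have x0: "x0 \<in> ?X" using k by (auto simp: x0_def)
  have "card P \<noteq> 0" using finX x0 by (auto simp: PX)
  \<comment> \<open>On an empty \<open>Q\<close> the infimum would be an unspecified value.\<close>
  then have Q0: "Q \<noteq> {}" using card by auto
  have "\<exists>y\<in>Q. norm (p x - y) < \<Delta> / 3" if "x \<in> ?X" for x
  proof -
    have "(INF y\<in>Q. norm (p x - y)) < \<Delta> / 3" using near that \<Delta> by (force simp: PX)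
    then show ?thesis using Q0 by (subst (asm) cINF_less_iff) (auto intro!: bdd_belowI[of _ 0])
  qed
  then obtain y where y: "\<And>x. x \<in> ?X \<Longrightarrow> y x \<in> Q" "\<And>x. x \<in> ?X \<Longrightarrow> norm (p x - y x) < \<Delta> / 3"
    by metis
  have diff: "p x - p x' = \<Delta> *\<^sub>R (\<Sum>e\<in>E. (real (x e) - real (x' e)) *\<^sub>R e)" for x x'
    by (simp add: p_def scaleR_diff_left sum_subtractf scaleR_diff_right)
  have far: "\<Delta> \<le> norm (p x - p x')" if xx: "x \<in> ?X" "x' \<in> ?X" "x \<noteq> x'" for x x'
  proof -
    obtain e where e: "e \<in> E" "x e \<noteq> x' e" using xx by (meson PiE_ext)
    have "(p x - p x') \<bullet> e = \<Delta> * (\<Sum>f\<in>E. (real (x f) - real (x' f)) * (f \<bullet> e))"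
      unfolding diff by (simp add: inner_sum_left)
    also have "(\<Sum>f\<in>E. (real (x f) - real (x' f)) * (f \<bullet> e)) =
        (\<Sum>f\<in>E. if f = e then real (x f) - real (x' f) else 0)"
      using E(1) e(1) by (intro sum.cong) (auto simp: inner_Basis subset_iff)
    also have "\<dots> = real (x e) - real (x' e)" using fin e(1) by simp
    finally have "\<bar>(p x - p x') \<bullet> e\<bar> = \<Delta> * \<bar>real (x e) - real (x' e)\<bar>"
      using \<Delta> by (simp add: abs_mult)
    moreover have "1 \<le> \<bar>real (x e) - real (x' e)\<bar>" using e(2) by linarith
    ultimately have "\<Delta> \<le> \<bar>(p x - p x') \<bullet> e\<bar>" using \<Delta> by simp
    also have "\<dots> \<le> norm (p x - p x')" using E(1) e(1) by (auto intro: Basis_le_norm)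
    finally show ?thesis .
  qed
  have km: "1 \<le> real (k * card E)" using k E(2) by (metis mult_le_mono nat_mult_1 of_nat_1 of_nat_le_iff)
  have inball: "y x \<in> cball (y x0) (2 * \<Delta> * real (k * card E)) \<inter> K" if x: "x \<in> ?X" for x
  proof -
    have "norm (\<Sum>e\<in>E. (real (x e) - real (x0 e)) *\<^sub>R e) \<le>
        (\<Sum>e\<in>E. norm ((real (x e) - real (x0 e)) *\<^sub>R e))" by (rule norm_sum)
    also have "\<dots> \<le> (\<Sum>e\<in>E. real k)"
    proof (rule sum_mono)
      fix e assume e: "e \<in> E"
      then have "norm e = 1" using E(1) by auto
      moreover have "x e < k" using x e by (auto dest: PiE_mem)
      ultimately show "norm ((real (x e) - real (x0 e)) *\<^sub>R e) \<le> real k"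
        using e by (simp add: x0_def)
    qed
    finally have "norm (p x - p x0) \<le> \<Delta> * real (k * card E)"
      unfolding diff using \<Delta> by (simp add: mult.commute)
    moreover have "dist (y x0) (y x) \<le> norm (p x0 - y x0) + norm (p x - p x0) + norm (p x - y x)"
      by (smt (verit) dist_norm dist_triangle norm_minus_commute)
    moreover have "norm (p x0 - y x0) < \<Delta> / 3" "norm (p x - y x) < \<Delta> / 3" using y(2) x x0 by auto
    moreover have "\<Delta> * 1 \<le> \<Delta> * real (k * card E)" using \<Delta> km by (intro mult_left_mono) auto
    ultimately have "dist (y x0) (y x) \<le> 2 * (\<Delta> * real (k * card E))" using \<Delta> by linarith
    then show ?thesis using y(1)[OF x] Q by (auto simp: mult.assoc)
  qed
  let ?A = "cball (y x0) (2 * \<Delta> * real (k * card E)) \<inter> K"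
  have "bounded ?A" using K by blast
  then obtain \<U> where U: "finite \<U>" "card \<U> = covering_number ?A (\<Delta> / 3)" "?A \<subseteq> \<Union>\<U>"
    "\<And>U. U \<in> \<U> \<Longrightarrow> open U \<and> bounded U \<and> diameter U \<le> \<Delta> / 3"
    using covering_number_attained[of ?A "\<Delta> / 3"] \<Delta> by (metis divide_pos_pos zero_less_numeral)
  have "\<exists>U\<in>\<U>. y x \<in> U" if "x \<in> ?X" for x using inball[OF that] U(3) by blast
  then obtain u where u: "\<And>x. x \<in> ?X \<Longrightarrow> u x \<in> \<U>" "\<And>x. x \<in> ?X \<Longrightarrow> y x \<in> u x" by metis
  have "inj_on u ?X"
  proof (rule inj_onI, rule ccontr)
    fix x x' assume xx: "x \<in> ?X" "x' \<in> ?X" "u x = u x'" "x \<noteq> x'"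
    have "dist (y x) (y x') \<le> diameter (u x)"
      using u xx U(4) by (intro diameter_bounded_bound) auto
    also have "\<dots> \<le> \<Delta> / 3" using u(1) xx U(4) by blast
    finally have "dist (y x) (y x') \<le> \<Delta> / 3" .
    moreover have "norm (p x - y x) < \<Delta> / 3" "norm (p x' - y x') < \<Delta> / 3" using y(2) xx by auto
    moreover have "norm (p x - p x') \<le> norm (p x - y x) + dist (y x) (y x') + norm (p x' - y x')"
      by (smt (verit) dist_norm dist_triangle norm_minus_commute)
    ultimately show False using far[OF xx(1,2,4)] by linarith
  qed
  then have "card ?X \<le> card \<U>" using u(1) U(1) by (intro card_inj_on_le[of u]) auto
  then have "k ^ card E \<le> covering_number ?A (\<Delta> / 3)" using U(2) fin by (simp add: card_PiE)
  moreover have "y x0 \<in> K" using y(1)[OF x0] Q by blast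
  ultimately show thesis using that \<Delta> by blast
qed

text \<open>Otherwise \<open>k powr (m - \<sigma>)\<close> would be bounded although its exponent is positive.\<close>

lemma exponent_le_of_power_bound:
  fixes c :: real
  assumes le: "\<And>k::nat. 3 \<le> k \<Longrightarrow> real k ^ m \<le> c * real k powr \<sigma>"
  shows "real m \<le> \<sigma>"
proof (rule ccontr)
  assume "\<not> real m \<le> \<sigma>"
  then have pos: "0 < real m - \<sigma>" by simp
  let ?b = "(\<bar>c\<bar> + 1) powr (1 / (real m - \<sigma>))"
  \<comment> \<open>This \<open>k\<close> is large enough for \<open>k powr (m - \<sigma>)\<close> to exceed \<open>c\<close>.\<close>
  obtain k :: nat where b: "3 + ?b \<le> real k" using real_arch_simple by blast
  have b0: "0 \<le> ?b" by simp
  have "\<bar>c\<bar> + 1 = ?b powr (real m - \<sigma>)" using pos by (simp add: powr_powr)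
  also have "\<dots> \<le> real k powr (real m - \<sigma>)"
    using b b0 pos by (intro powr_mono2) linarith+
  finally have "c < real k powr (real m - \<sigma>)" by linarith
  moreover have "3 \<le> k" using b b0 by linarith
  ultimately have k: "3 \<le> k" "c < real k powr (real m - \<sigma>)" by auto
  have "c * real k powr \<sigma> < real k powr (real m - \<sigma>) * real k powr \<sigma>"
    using k by (intro mult_strict_right_mono) auto
  also have "\<dots> = real k powr real m" by (simp flip: powr_add)
  also have "\<dots> = real k ^ m" using k(1) by (simp add: powr_realpow)
  finally show False using le[OF k(1)] by simp
qed

text \<open>Balls of radius \<open>2 k (card E) \<Delta>\<close> and covering sets of diameter \<open>\<Delta>/3\<close> have the ratio
  \<open>R / r = 6 k (card E)\<close>, in which the uncontrolled scale \<open>\<Delta>\<close> has cancelled, while at least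
  \<open>k\<^bsup>card E\<^esup>\<close> covering sets are needed.\<close>

lemma assouad_dim_ge:
  fixes E K :: "'a::euclidean_space set"
  assumes E: "E \<subseteq> Basis" "1 \<le> card E" and K: "bounded K"
    and AP: "\<And>k. 3 \<le> k \<Longrightarrow> \<exists>Q\<subseteq>K. is_AP k (1/4) E Q"
  shows "ereal (real (card E)) \<le> assouad_dim K"
  unfolding assouad_dim_def
proof (rule INF_greatest)
  fix \<sigma> assume "\<sigma> \<in> {\<sigma>. \<sigma> \<ge> 0 \<and> (\<exists>C>0. \<forall>R>0. \<forall>r\<in>{0<..<R}. \<forall>x\<in>K.
    real (covering_number (cball x R \<inter> K) r) \<le> C * (R / r) powr \<sigma>)}"
  then obtain C where C: "\<And>R r x. 0 < r \<Longrightarrow> r < R \<Longrightarrow> x \<in> K \<Longrightarrow>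
      real (covering_number (cball x R \<inter> K) r) \<le> C * (R / r) powr \<sigma>"
    by (simp only: mem_Collect_eq) (metis greaterThanLessThan_iff order_less_trans)
  let ?m = "card E"
  have "real k ^ ?m \<le> (C * (6 * real ?m) powr \<sigma>) * real k powr \<sigma>" if k: "3 \<le> k" for k
  proof -
    obtain Q where Q: "Q \<subseteq> K" "is_AP k (1/4) E Q" using AP k by blast
    have "1 \<le> k" using k by simp
    then obtain \<Delta> y where \<Delta>: "0 < \<Delta>" "y \<in> K"
      "k ^ ?m \<le> covering_number (cball y (2 * \<Delta> * real (k * ?m)) \<inter> K) (\<Delta> / 3)"
      using AP_covering_number[OF E _ Q(2,1) K] by blast
    let ?R = "2 * \<Delta> * real (k * ?m)"
    have "1 \<le> real (k * ?m)" using k E(2) \<open>1 \<le> k\<close>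
      by (metis mult_le_mono nat_mult_1 of_nat_1 of_nat_le_iff)
    then have "2 * \<Delta> * 1 \<le> ?R" using \<Delta>(1) by (intro mult_left_mono) auto
    then have lt: "\<Delta> / 3 < ?R" using \<Delta>(1) by linarith
    have "real k ^ ?m \<le> real (covering_number (cball y ?R \<inter> K) (\<Delta> / 3))"
      using \<Delta>(3) by (metis of_nat_le_iff of_nat_power)
    also have "\<dots> \<le> C * (?R / (\<Delta> / 3)) powr \<sigma>" using C[OF _ lt \<Delta>(2)] \<Delta>(1) by simp
    also have "?R / (\<Delta> / 3) = (6 * real ?m) * real k" using \<Delta>(1) by simp
    also have "((6 * real ?m) * real k) powr \<sigma> = (6 * real ?m) powr \<sigma> * real k powr \<sigma>"
      by (simp add: powr_mult)
    finally show ?thesis by (simp only: mult.assoc)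
  qed
  then have "real ?m \<le> \<sigma>" by (rule exponent_le_of_power_bound)
  then show "ereal (real ?m) \<le> ereal \<sigma>" by simp
qed

section \<open>The compact set\<close>

theorem theorem4p1:
  fixes m :: nat
  assumes "CARD('n::finite) \<ge> 2" and "1 \<le> m" and "m \<le> CARD('n)"
  shows "\<exists>K :: (real ^ 'n) set.
    compact K \<and>
    (\<forall>k::nat. \<forall>\<epsilon>::real. \<forall>E \<in> indep_sets_of_card m.
       k \<ge> 3 \<longrightarrow> 0 < \<epsilon> \<longrightarrow> \<epsilon> < 1 \<longrightarrow> (\<exists>Q. Q \<subseteq> K \<and> is_AP k \<epsilon> E Q)) \<and>
    assouad_dim K = ereal (real m)"
proof -
  obtain D :: "(real ^ 'n) set" where D: "countable D"
    "\<And>X. open X \<Longrightarrow> X \<noteq> {} \<Longrightarrow> \<exists>d\<in>D. d \<in> X"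
    using countable_dense_setE by blast
  define I where "I = (UNIV :: nat set) \<times> {W. finite W \<and> W \<subseteq> D \<and> card W \<le> m}"
  have "countable {W. finite W \<and> W \<subseteq> D}"
    using countable_Collect_finite_subset[OF D(1)] by (simp add: conj_commute)
  then have "countable {W. finite W \<and> W \<subseteq> D \<and> card W \<le> m}"
    by (rule countable_subset[rotated]) auto
  then have "countable I" by (simp add: I_def)
  moreover have "(0, {}) \<in> I" by (simp add: I_def)
  ultimately obtain \<phi> :: "nat \<Rightarrow> nat \<times> (real ^ 'n) set" where \<phi>: "range \<phi> = I"
    by (metis empty_iff range_from_nat_into)
  define S where "S = (\<lambda>j. grid_box (fst (\<phi> j)) (snd (\<phi> j)))"
  have \<phi>I: "finite (snd (\<phi> j)) \<and> card (snd (\<phi> j)) \<le> m" for j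
    using \<phi> rangeI[of \<phi> j] by (auto simp: I_def)
  have "finite (S j)" for j using \<phi>I by (simp add: S_def finite_grid_box)
  note finS = this
  obtain \<delta> scale where sc: "\<And>j. 0 < scale j" "\<And>j. 0 < \<delta> j" "\<And>j. \<delta> (Suc j) \<le> \<delta> j / 2" "\<delta> \<longlonglongrightarrow> 0"
    "\<And>j s. s \<in> S j \<Longrightarrow> norm (scale j *\<^sub>R s) \<le> \<delta> j"
    "\<And>j s. s \<in> S j \<Longrightarrow> s \<noteq> 0 \<Longrightarrow> 3 * \<delta> (Suc j) \<le> norm (scale j *\<^sub>R s)"
    using lacunary_scaling[of S, OF finS] by metis
  \<comment> \<open>The origin is a point of most grids; it is split off so that the remaining points obey the lower
    bound on the norm.\<close>
  define Q where "Q = (\<lambda>j. (*\<^sub>R) (scale j) ` S j - {0})"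
  define K where "K = insert 0 (\<Union>j. Q j)"
  have Q: "finite (Q j)" "Q j \<subseteq> cball 0 (\<delta> j)" "\<And>y. y \<in> Q j \<Longrightarrow> 3 * \<delta> (Suc j) \<le> norm y"
    "Q j \<subseteq> span (snd (\<phi> j))" for j
  proof -
    show "finite (Q j)" by (simp add: Q_def finS)
    show "Q j \<subseteq> cball 0 (\<delta> j)" unfolding Q_def using sc(5) by (auto simp del: norm_scaleR)
    show "3 * \<delta> (Suc j) \<le> norm y" if "y \<in> Q j" for y
      using that sc(6) unfolding Q_def by (auto simp del: norm_scaleR)
    show "Q j \<subseteq> span (snd (\<phi> j))"
      unfolding Q_def S_def using grid_box_subset_span by (blast intro: span_scale)
  qed
  have "compact K" unfolding K_def by (rule compact_shrinking_union[OF Q(1,2) sc(4)])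
  moreover have AP: "\<exists>Q. Q \<subseteq> K \<and> is_AP k \<epsilon> E Q"
    if E: "E \<in> indep_sets_of_card m" and \<epsilon>: "0 < \<epsilon>" for k \<epsilon> E
  proof -
    have indep: "independent E" and card: "card E = m"
      using E by (auto simp: indep_sets_of_card_def)
    obtain W where W: "W \<subseteq> D" "finite W" "card W = card E"
      "card (grid_box k W) = card (grid_box k E)"
      "\<And>x. x \<in> grid_box k E \<Longrightarrow> \<exists>y\<in>grid_box k W. norm (x - y) \<le> \<epsilon>"
      using grid_box_perturbation[OF indep \<epsilon> D(2), where k = k] by metis
    then have "(k, W) \<in> range \<phi>" unfolding \<phi> by (simp add: I_def card)
    then obtain j where j: "\<phi> j = (k, W)" by (metis rangeE)
    have "(*\<^sub>R) (scale j) ` grid_box k W \<subseteq> insert 0 (Q j)"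
      by (auto simp: Q_def S_def j)
    then have "(*\<^sub>R) (scale j) ` grid_box k W \<subseteq> K" unfolding K_def by blast
    moreover have "is_AP k \<epsilon> E ((*\<^sub>R) (scale j) ` grid_box k W)"
      using is_AP_scaled_grid_box[OF sc(1) W(2,4,5)] by blast
    ultimately show ?thesis by blast
  qed
  moreover have "assouad_dim K = ereal (real m)"
  proof (rule antisym)
    let ?C = "2 * real (8 * m + 11) ^ m * 4 ^ m + 1"
    have "real (covering_number (cball x R \<inter> K) r) \<le> ?C * (R / r) powr real m"
      if r: "0 < r" "r < R" for R r x
    proof -
      have dim: "dim (span (snd (\<phi> j))) \<le> m" for j
        using dim_le_card'[of "snd (\<phi> j)"] \<phi>I[of j] by simp
      obtain T where T: "finite T" "real (card T) \<le> ?C * (R / r) ^ m"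
        "cball x R \<inter> K \<subseteq> (\<Union>c\<in>T. ball c (r/2))"
        using lacunary_ball_cover[where V = "\<lambda>j. span (snd (\<phi> j))" and Q = Q and \<delta> = \<delta>,
            OF subspace_span dim Q(4,2,3) sc(2,3) assms(2) r, of x]
        unfolding K_def by blast
      show ?thesis
        using covering_number_le_card[OF T(1,3) r(1)] T(2) r by (simp add: powr_realpow)
    qed
    moreover have "0 < ?C" by (simp add: add_nonneg_pos)
    ultimately have "real m \<in> {\<sigma>. \<sigma> \<ge> 0 \<and> (\<exists>C>0. \<forall>R>0. \<forall>r\<in>{0<..<R}. \<forall>x\<in>K.
        real (covering_number (cball x R \<inter> K) r) \<le> C * (R / r) powr \<sigma>)}"
      by (intro CollectI conjI exI[of _ ?C]) auto
    then show "assouad_dim K \<le> ereal (real m)"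
      unfolding assouad_dim_def by (rule INF_lower)
    obtain E where E: "E \<subseteq> (Basis :: (real ^ 'n) set)" "card E = m"
      using obtain_subset_with_card_n[of m "Basis :: (real ^ 'n) set"] assms(3) by auto
    have "E \<in> indep_sets_of_card m"
      using E finite_subset[OF E(1) finite_Basis] independent_mono[OF independent_Basis E(1)]
      by (simp add: indep_sets_of_card_def)
    then have "\<exists>Q\<subseteq>K. is_AP k (1/4) E Q" for k using AP by auto
    then show "ereal (real m) \<le> assouad_dim K"
      using assouad_dim_ge[OF E(1)] E(2) assms(2) compact_imp_bounded[OF \<open>compact K\<close>] by auto
  qed
  ultimately show ?thesis by blast
qed

end
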